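(* Let $\mathcal{G}$ be a finite simple graph with vertex set $\{1,\dots,n\}$, and suppose that $\mathcal{G}$ has exactly $\sigma$ independent maximal cliques. Then there exists a string $x=x[1..n]$ on a base alphabet of size $\sigma$ whose associated graph satisfies $\mathcal{G}_x=\mathcal{G}$, and there is no such string on a base alphabet of size smaller than $\sigma$.
   Context: A string with base alphabet $\Sigma$ (a finite set) is either empty or a finite sequence $x=x[1..n]$ of nonempty subsets (letters) of $\Sigma$. Two letters match, written $\approx$, if they have nonempty intersection. The associated graph $\mathcal{G}_x$ of $x$ is the simple graph (undirected, without loops or multiple edges) with vertex set $\{1,\dots,n\}$ whose edges are the pairs $(i,j)$, $i\ne j$, with $x[i]\approx x[j]$. A maximal clique of a graph is a clique (complete subgraph) that is not a subgraph of any other clique. Let $\mathcal{S}$ be the set of all maximal cliques of a finite simple graph $\mathcal{G}=(V,E)$, and let $\mathcal{I}$ be a smallest subset of $\mathcal{S}$ such that every edge of $E$ occurs at least once in $\mathcal{I}$ (that is, in at least one member of $\mathcal{I}$). The maximal cliques in $\mathcal{I}$ are said to be independent, and those in $\mathcal{S}\setminus\mathcal{I}$ dependent. The set $\mathcal{I}$ need not be unique, but its cardinality is determined by $\mathcal{G}$; "exactly $\sigma$ independent maximal cliques" means $|\mathcal{I}|=\sigma$.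
   Formalization: The existence of a string on a base alphabet of size σ is claimed only for graphs without isolated vertices, since it fails whenever an isolated vertex is present (e.g. one vertex, no edges: σ = 0); the minimality part is claimed for all graphs. *)

theory Defs
  imports "Graph_Theory.Graph_Theory"
begin

definition is_string :: "'s set \<Rightarrow> 's set list \<Rightarrow> bool" where
  "is_string \<Sigma> x \<longleftrightarrow> finite \<Sigma> \<and> (\<forall>a\<in>set x. a \<noteq> {} \<and> a \<subseteq> \<Sigma>)"

definition letter_match :: "'s set \<Rightarrow> 's set \<Rightarrow> bool" (infix \<open>\<approx>\<^sub>l\<close> 50) where
  "a \<approx>\<^sub>l b \<longleftrightarrow> a \<inter> b \<noteq> {}"

text \<open>
  Undirected simple graphs are symmetric loop-free digraphs (\<^locale>\<open>pair_graph\<close>): an edge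
  between \<open>i\<close> and \<open>j\<close> is the pair of arcs \<open>(i, j)\<close> and \<open>(j, i)\<close>. String positions count from 1,
  list indices from 0.
\<close>

definition associated_graph :: "'s set list \<Rightarrow> nat pair_pre_digraph" where
  "associated_graph x =
     \<lparr> pverts = {1..length x},
       parcs = {(i, j). i \<in> {1..length x} \<and> j \<in> {1..length x} \<and> i \<noteq> j
                        \<and> x ! (i - 1) \<approx>\<^sub>l x ! (j - 1)} \<rparr>"

definition clique :: "'a pair_pre_digraph \<Rightarrow> 'a pair_pre_digraph \<Rightarrow> bool" where
  "clique G K \<longleftrightarrow>
     subgraph (with_proj K) (with_proj G) \<and> complete_digraph (card (pverts K)) (with_proj K)"

definition maximal_cliques :: "'a pair_pre_digraph \<Rightarrow> 'a pair_pre_digraph set" where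
  "maximal_cliques G =
     {K. clique G K \<and>
         \<not> (\<exists>K'. clique G K' \<and> K' \<noteq> K \<and> subgraph (with_proj K) (with_proj K'))}"

definition covers_edges :: "'a pair_pre_digraph \<Rightarrow> 'a pair_pre_digraph set \<Rightarrow> bool" where
  "covers_edges G C \<longleftrightarrow> (\<forall>e\<in>parcs G. \<exists>K\<in>C. e \<in> parcs K)"

definition independent_cliques :: "'a pair_pre_digraph \<Rightarrow> 'a pair_pre_digraph set \<Rightarrow> bool" where
  "independent_cliques G I \<longleftrightarrow>
     I \<subseteq> maximal_cliques G \<and> covers_edges G I \<and>
     (\<forall>J. J \<subseteq> maximal_cliques G \<and> covers_edges G J \<longrightarrow> card I \<le> card J)"

text \<open>
  An isolated vertex \<open>v\<close> lies on no edge, so its maximal clique \<open>{v}\<close> never occurs in a smallest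
  edge cover, whereas in a string every position carries a nonempty letter, and the letter at \<open>v\<close>
  must consist of symbols used nowhere else. A graph with an isolated vertex therefore never has
  a string on an alphabet whose size is the number of its independent maximal cliques.
\<close>

definition no_isolated_vertex :: "'a pair_pre_digraph \<Rightarrow> bool" where
  "no_isolated_vertex G \<longleftrightarrow> (\<forall>v\<in>pverts G. \<exists>w. (v, w) \<in> parcs G)"

end

(* Symbols of the alphabet correspond to cliques: in a string, the positions whose letter
   contains a given symbol form a clique, and two positions match iff some symbol's clique
   contains both. Conversely, an edge cover by cliques C turns into a string whose letter at
   position i is the set of members of C through i. For the lower bound each symbol's clique is
   enlarged to a maximal one, which gives a cover with at most as many members as symbols. *)
theory Submission
  imports Defs
begin

text \<open>Canonical form of a clique: the record is fixed by its vertex set, so statements about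
  subgraphs become statements about sets.\<close>

definition complete_on :: "'a set \<Rightarrow> 'a pair_pre_digraph" where
  "complete_on V = \<lparr> pverts = V, parcs = {(u, v). u \<in> V \<and> v \<in> V \<and> u \<noteq> v} \<rparr>"

lemma complete_on_simps [simp]:
  "pverts (complete_on V) = V"
  "parcs (complete_on V) = {(u, v). u \<in> V \<and> v \<in> V \<and> u \<noteq> v}"
  by (simp_all add: complete_on_def)

lemma subgraph_with_proj_iff:
  "subgraph (with_proj H) (with_proj G) \<longleftrightarrow>
     pverts H \<subseteq> pverts G \<and> parcs H \<subseteq> parcs G \<and> pair_wf_digraph G \<and> pair_wf_digraph H"
  by (auto simp: subgraph_def wf_digraph_wp_iff)

lemma pair_wf_digraph_complete_on: "pair_wf_digraph (complete_on V)"
  by unfold_locales auto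

lemma subgraph_complete_on_iff:
  "subgraph (with_proj (complete_on U)) (with_proj (complete_on V)) \<longleftrightarrow> U \<subseteq> V"
  by (auto simp: subgraph_with_proj_iff pair_wf_digraph_complete_on)

lemma complete_digraph_with_proj_iff:
  "complete_digraph n (with_proj K) \<longleftrightarrow>
     finite (pverts K) \<and> card (pverts K) = n \<and> K = complete_on (pverts K)"
  unfolding complete_digraph_pair_def
  by (cases K) (auto simp: complete_on_def)

context pair_graph
begin

text \<open>Recovers the usual description by pairwise adjacency. The finiteness that
  \<open>complete_digraph\<close> demands is inherited from \<open>pverts G\<close>.\<close>

lemma clique_complete_on_iff:
  "clique G (complete_on V) \<longleftrightarrow> V \<subseteq> pverts G \<and> (\<forall>u\<in>V. \<forall>v\<in>V. u \<noteq> v \<longrightarrow> (u, v) \<in> parcs G)"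
proof -
  have "pair_wf_digraph G" by unfold_locales
  then show ?thesis
    by (auto simp: clique_def subgraph_with_proj_iff complete_digraph_with_proj_iff
        pair_wf_digraph_complete_on intro: finite_subset[OF _ pair_finite_verts])
qed

lemma clique_eq_complete_on: "clique G K \<Longrightarrow> K = complete_on (pverts K)"
  by (simp add: clique_def complete_digraph_with_proj_iff)

text \<open>Cliques are determined by subsets of the finite vertex set. This makes \<open>I\<close>
  finite, so that its members can be numbered.\<close>

lemma finite_maximal_cliques: "finite (maximal_cliques G)"
proof (rule finite_subset)
  show "maximal_cliques G \<subseteq> complete_on ` Pow (pverts G)"
  proof
    fix K assume "K \<in> maximal_cliques G"
    then have "clique G K" by (simp add: maximal_cliques_def)
    with clique_eq_complete_on clique_complete_on_iff
    show "K \<in> complete_on ` Pow (pverts G)" by (metis PowI imageI)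
  qed
qed (simp add: pair_finite_verts)

text \<open>The vertex sets of cliques form a finite family, so above each of them lies an
  inclusion-maximal one.\<close>

lemma maximal_clique_extends:
  assumes "clique G (complete_on V)"
  obtains W where "V \<subseteq> W" "complete_on W \<in> maximal_cliques G"
proof -
  let ?A = "{W. clique G (complete_on W)}"
  have "?A \<subseteq> Pow (pverts G)"
    by (auto simp: clique_complete_on_iff)
  then have "finite ?A"
    by (rule finite_subset) (simp add: pair_finite_verts)
  moreover have "V \<in> ?A" using assms by simp
  ultimately obtain W where W: "W \<in> ?A" "V \<subseteq> W" "\<And>U. U \<in> ?A \<Longrightarrow> W \<subseteq> U \<Longrightarrow> W = U"
    using finite_has_maximal2[of ?A V] by metis
  have "complete_on W \<in> maximal_cliques G"
    unfolding maximal_cliques_def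
  proof (safe)
    show "clique G (complete_on W)" using W(1) by simp
  next
    fix K assume K: "clique G K" "K \<noteq> complete_on W"
      "subgraph (with_proj (complete_on W)) (with_proj K)"
    \<comment> \<open>Every competitor \<open>K\<close> is again of the form
      \<open>complete_on U\<close>, so maximality among vertex sets carries over to the subgraph
      order.\<close>
    define U where "U = pverts K"
    have eq: "K = complete_on U"
      using clique_eq_complete_on[OF K(1)] by (simp add: U_def)
    have "W = U"
      using K W(3)[of U] by (simp add: eq subgraph_complete_on_iff)
    then show False using K(2) eq by simp
  qed
  with W(2) show ?thesis by (rule that)
qed

end

text \<open>The map \<open>h\<close> renames cliques to symbols, which leaves the symbol type free;
  injectivity keeps different cliques from merging into one symbol and creating false
  matches.\<close>

lemma string_of_clique_cover:
  assumes "pair_graph G" and verts: "pverts G = {1..n}" and noiso: "no_isolated_vertex G"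
    and cover: "covers_edges G C" and cl: "\<And>K. K \<in> C \<Longrightarrow> clique G K"
    and inj: "inj_on h C" and fin: "finite C"
  shows "\<exists>x. is_string (h ` C) x \<and> length x = n \<and> associated_graph x = G"
proof -
  interpret pair_graph G by fact
  define L where "L i = h ` {K \<in> C. i \<in> pverts K}" for i
  \<comment> \<open>List index \<open>i\<close> carries the letter of vertex \<open>i + 1\<close>,
    in agreement with \<open>x ! (i - 1)\<close> in \<open>associated_graph\<close>.\<close>
  define x where "x = map (\<lambda>i. L (Suc i)) [0..<n]"
  have [simp]: "length x = n" by (simp add: x_def)
  have nth: "x ! (i - 1) = L i" if "i \<in> {1..n}" for i
    using that by (cases i) (simp_all add: x_def del: upt_Suc)
  have K_parcs: "(i, j) \<in> parcs K \<longleftrightarrow> i \<in> pverts K \<and> j \<in> pverts K \<and> i \<noteq> j"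
    if "K \<in> C" for K i j
  proof -
    have "parcs K = parcs (complete_on (pverts K))"
      using clique_eq_complete_on[OF cl[OF that]] by (rule arg_cong)
    then show ?thesis by simp
  qed
  have common: "\<exists>K\<in>C. i \<in> pverts K \<and> j \<in> pverts K" if "(i, j) \<in> parcs G" for i j
    using cover that K_parcs unfolding covers_edges_def by blast
  have K_sub: "parcs K \<subseteq> parcs G" if "K \<in> C" for K
    using cl[OF that] by (simp add: clique_def subgraph_with_proj_iff)
  have match: "L i \<approx>\<^sub>l L j \<longleftrightarrow> (\<exists>K\<in>C. i \<in> pverts K \<and> j \<in> pverts K)" for i j
    using inj by (auto simp: L_def letter_match_def inj_on_def)
  have arc_iff: "(i, j) \<in> parcs G \<longleftrightarrow> i \<noteq> j \<and> L i \<approx>\<^sub>l L j" for i j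
  proof
    assume "(i, j) \<in> parcs G"
    then show "i \<noteq> j \<and> L i \<approx>\<^sub>l L j"
      using common match pair_no_loops by fastforce
  next
    assume "i \<noteq> j \<and> L i \<approx>\<^sub>l L j"
    then obtain K where "K \<in> C" "(i, j) \<in> parcs K"
      using match K_parcs by blast
    then show "(i, j) \<in> parcs G" using K_sub by blast
  qed
  \<comment> \<open>\<open>arc_iff\<close> has no range condition, while the arcs of
    \<open>associated_graph x\<close> are confined to positions of \<open>x\<close>.\<close>
  have arc_verts: "i \<in> {1..n} \<and> j \<in> {1..n}" if "(i, j) \<in> parcs G" for i j
    using wellformed'[OF that] verts by blast
  \<comment> \<open>A vertex with a neighbour lies on an edge, and the clique covering that edge
    puts a symbol into its letter.\<close>
  have "L i \<noteq> {}" if "i \<in> {1..n}" for i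
    using that noiso verts common unfolding no_isolated_vertex_def L_def by blast
  then have "is_string (h ` C) x"
    using fin by (auto simp: is_string_def x_def L_def)
  moreover have "associated_graph x = G"
  proof (rule pair_pre_digraph.equality)
    show "parcs (associated_graph x) = parcs G"
      using nth arc_iff arc_verts by (auto simp: associated_graph_def)
  qed (simp_all add: associated_graph_def verts)
  ultimately show ?thesis by auto
qed

text \<open>Every edge comes from a symbol shared by its two ends, so it lies in that symbol's
  clique and survives the enlargement to a maximal one.\<close>

lemma maximal_clique_cover_of_string:
  assumes "pair_graph G" and str: "is_string \<Sigma> x" and G: "associated_graph x = G"
  obtains J where "J \<subseteq> maximal_cliques G" "covers_edges G J" "card J \<le> card \<Sigma>"
proof -
  interpret pair_graph G by fact
  define P where "P a = {i \<in> {1..length x}. a \<in> x ! (i - 1)}" for a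
  \<comment> \<open>Positions sharing \<open>a\<close> match pairwise; a symbol that occurs nowhere
    gives the empty clique, which can be enlarged as well.\<close>
  have "clique G (complete_on (P a))" for a
    unfolding clique_complete_on_iff
    by (auto simp: G[symmetric] associated_graph_def P_def letter_match_def)
  then have "\<exists>W. P a \<subseteq> W \<and> complete_on W \<in> maximal_cliques G" for a
    using maximal_clique_extends by metis
  then obtain W where W: "\<And>a. P a \<subseteq> W a" "\<And>a. complete_on (W a) \<in> maximal_cliques G"
    by metis
  have "covers_edges G ((\<lambda>a. complete_on (W a)) ` \<Sigma>)"
    unfolding covers_edges_def
  proof
    fix e assume "e \<in> parcs G"
    then obtain i j where e: "e = (i, j)" "i \<in> {1..length x}" "j \<in> {1..length x}" "i \<noteq> j"
      "x ! (i - 1) \<approx>\<^sub>l x ! (j - 1)"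
      by (auto simp: G[symmetric] associated_graph_def)
    then obtain a where a: "a \<in> x ! (i - 1)" "a \<in> x ! (j - 1)"
      by (auto simp: letter_match_def)
    have "x ! (i - 1) \<in> set x" using e(2) by (intro nth_mem) auto
    then have "a \<in> \<Sigma>" using str a(1) by (auto simp: is_string_def)
    moreover have "i \<in> W a" "j \<in> W a"
      using a e W(1)[of a] by (auto simp: P_def)
    ultimately show "\<exists>K\<in>(\<lambda>a. complete_on (W a)) ` \<Sigma>. e \<in> parcs K"
      using e by auto
  qed
  \<comment> \<open>Only an inequality: different symbols may be enlarged to the same maximal
    clique.\<close>
  moreover have "card ((\<lambda>a. complete_on (W a)) ` \<Sigma>) \<le> card \<Sigma>"
    using str by (intro card_image_le) (simp add: is_string_def)
  ultimately show ?thesis using W(2) by (intro that) auto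
qed

text \<open>Existence is stated over \<open>nat\<close>, which has enough symbols for every finite
  cover; the lower bound is stated for an arbitrary symbol type \<open>'s\<close>.\<close>

theorem lemma20:
  fixes G :: "nat pair_pre_digraph" and n \<sigma> :: nat and I :: "nat pair_pre_digraph set"
  assumes "pair_graph G" and "pverts G = {1..n}"
    and "independent_cliques G I" and "card I = \<sigma>"
  shows "(no_isolated_vertex G \<longrightarrow>
            (\<exists>(\<Sigma> :: nat set) x. is_string \<Sigma> x \<and> length x = n \<and> card \<Sigma> = \<sigma>
                                \<and> associated_graph x = G))
       \<and> \<not> (\<exists>(\<Sigma> :: 's set) x. is_string \<Sigma> x \<and> length x = n \<and> card \<Sigma> < \<sigma>
                                \<and> associated_graph x = G)"
proof -
  interpret pair_graph G by fact
  have I: "I \<subseteq> maximal_cliques G" "covers_edges G I"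
    and minimal: "\<And>J. J \<subseteq> maximal_cliques G \<Longrightarrow> covers_edges G J \<Longrightarrow> \<sigma> \<le> card J"
    using assms(3,4) by (auto simp: independent_cliques_def)
  have finI: "finite I"
    using I(1) finite_maximal_cliques by (rule finite_subset)
  show ?thesis
  proof (intro conjI impI notI)
    assume noiso: "no_isolated_vertex G"
    obtain h :: "nat pair_pre_digraph \<Rightarrow> nat" where h: "inj_on h I"
      using finite_imp_inj_to_nat_seg[OF finI] by blast
    have "clique G K" if "K \<in> I" for K
      using that I(1) by (auto simp: maximal_cliques_def)
    then obtain x where "is_string (h ` I) x" "length x = n" "associated_graph x = G"
      using string_of_clique_cover[OF assms(1,2) noiso I(2) _ h finI] by blast
    moreover have "card (h ` I) = \<sigma>"
      using card_image[OF h] assms(4) by simp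
    ultimately show "\<exists>(\<Sigma> :: nat set) x. is_string \<Sigma> x \<and> length x = n \<and> card \<Sigma> = \<sigma>
        \<and> associated_graph x = G"
      by blast
  next
    assume "\<exists>(\<Sigma> :: 's set) x. is_string \<Sigma> x \<and> length x = n \<and> card \<Sigma> < \<sigma> \<and> associated_graph x = G"
    then obtain \<Sigma> :: "'s set" and x where
      x: "is_string \<Sigma> x" "associated_graph x = G" and less: "card \<Sigma> < \<sigma>"
      by blast
    \<comment> \<open>The cover read off from \<open>x\<close> would be smaller than the minimum
      \<sigma>.\<close>
    obtain J where "J \<subseteq> maximal_cliques G" "covers_edges G J" "card J \<le> card \<Sigma>"
      using maximal_clique_cover_of_string[OF assms(1) x] .
    with minimal[of J] less show False by simp
  qed
qed

end
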